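(* Let $\epsilon>0$, and suppose $d$ is a sufficiently large positive integer. Let $k=\Theta(d)$ be an even integer with $2\le k\le d$, set $t=k/2$, and let $p\in[0,1/3]$. Let $\mathcal{B}=\binom{[d]}{k}$ be the collection of all size-$k$ subsets of $[d]$. Let $X=(x_1\ \cdots\ x_d)\in\mathbb{R}^{n\times d}$ be the matrix of input bits and $E=(x'_{d+1}\ \cdots\ x'_{d+t})\in\mathbb{R}^{n\times t}$ the matrix of noisy intermediate vectors of the $k$-bit $p$-noisy Boolean problem, AND or OR (all defined in the context). Assume $n=\Omega(d^\epsilon)$ and consider any $O(d^{-1-\epsilon/4})$-approximate gradient oracle $\widetilde\nabla$. Let the weights be initialized as $W^{(0)}=\mathbf{0}_{d\times t}$. Let $v_b\in\{0,1\}^d$ denote the indicator vector of the subset $b\subseteq[d]$. Since the ground-truth vector $v_b$ is unknown, define the surrogate function $$L(W)=\frac{1}{2n}\|\mathrm{Att}_W(X)-E\|_F^2,\qquad \mathrm{Att}_W(X)=X\,\mathrm{softmax}(W),\quad W\in\mathbb{R}^{d\times t},$$ which is used, instead of the loss $\|2\,\mathrm{softmax}(W^{(1)})\mathbf{1}_t-v_b\|_\infty$, to find the target weight matrix. Set the learning rate $\eta=\Theta(d^{1+\epsilon/8})$, and choose $\kappa\in[d^{-1},1]$ (specifically $\kappa=O(d^{-\epsilon/4})$). Let $W^{(1)}=W^{(0)}-\eta\,\widetilde\nabla L(W^{(0)})$ be the one-step gradient update. Then for any target subset $b\in\mathcal{B}$, the algorithm solves the $k$-bit $p$-noisy Boolean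 problem over $d$-bit inputs, in the following sense. Let $\phi:\mathbb{R}\to\mathbb{R}$ be given by $\phi(x)=0$ if $x\le 0.5\,d^{\epsilon/8}$ and $\phi(x)=1$ otherwise, applied entrywise to matrices. With probability at least $1-\exp(-\Theta(d^{\epsilon/2}))$ over the randomness in sampling and the effect of the noise, the one-step update $W^{(1)}\in\mathbb{R}^{d\times t}$ satisfies $$\phi(W^{(1)})\,\mathbf{1}_t=v_b.$$
   Context: $[m]=\{1,\dots,m\}$; $\mathbf{1}_t$ is the all-ones vector of length $t$; $\mathbf{0}_{d\times t}$ is the zero matrix. The column-wise softmax is $\mathrm{softmax}(W)_{j,m}=e^{W_{j,m}}/\sum_{i=1}^d e^{W_{i,m}}$. A $\delta$-approximate gradient oracle for $L$ returns $\widetilde\nabla L(W)$ each of whose entries differs from the corresponding entry of $\nabla L(W)$ by at most $\delta$ in absolute value. The parameter $\kappa$ is an auxiliary concentration level and does not enter the definition of $L$, the update or the conclusion. The $k$-bit $p$-noisy Boolean problem: let $b\in\mathcal{B}$ be an unknown subset with elements $j_1,\dots,j_k$. The inputs $x^1,\dots,x^n$ are samples from $\mathrm{Unif}(\{0,1\}^d)$, and $x_j\in\mathbb{R}^n$ is defined by $(x_j)_l=(x^l)_j$ for $j\in[d]$, $l\in[n]$. The target is $y_{\mathsf{and}}(x)=\prod_{m=d+1}^{d+t}x'_m$ or $y_{\mathsf{or}}(x)=1-\prod_{m=d+1}^{d+t}(1-x'_m)$, where the noisy intermediate vectors $x'_{d+i}\in\mathbb{R}^n$ are defined, for each $i\in[t]$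 and $l\in[n]$, as follows. - $p$-noisy AND: $(x'_{d+i})_l=(x_{j_{2i-1}})_l(x_{j_{2i}})_l$ with probability $1-p$, and $(x'_{d+i})_l=1-(x_{j_{2i-1}})_l(x_{j_{2i}})_l$ with probability $p$. - $p$-noisy OR: $(x'_{d+i})_l=1-(x_{j_{2i-1}})_l(x_{j_{2i}})_l$ with probability $1-p$, and $(x'_{d+i})_l=(x_{j_{2i-1}})_l(x_{j_{2i}})_l$ with probability $p$. Given $n$ samples, the goal is to predict the size-$k$ subset $b$ deciding the function.
   Formalization: The learning rate is a suitably chosen η with |η|=Θ(d^{1+ε/8}): positive for AND, but allowed to be (and taken) negative for OR, since with the noisy OR defined as 1 minus the product a positive rate makes the relevant weights negative and the claim fails. *)

theory Defs
  imports
    "HOL-Probability.Probability"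
    "HOL-Library.Landau_Symbols"
    "Jordan_Normal_Form.Matrix"
begin

(* Bits, samples, features and columns are numbered from 0 throughout. *)

definition softmax :: "real mat \<Rightarrow> real mat" where
  "softmax W = Matrix.mat (dim_row W) (dim_col W)
     (\<lambda>(j, m). exp (W $$ (j, m)) / (\<Sum>i<dim_row W. exp (W $$ (i, m))))"

definition attention :: "real mat \<Rightarrow> real mat \<Rightarrow> real mat" where
  "attention W X = X * softmax W"

definition frobenius_norm :: "real mat \<Rightarrow> real" where
  "frobenius_norm A = sqrt (\<Sum>i<dim_row A. \<Sum>j<dim_col A. (A $$ (i, j))\<^sup>2)"

definition surrogate_loss :: "real mat \<Rightarrow> real mat \<Rightarrow> real mat \<Rightarrow> real" where
  "surrogate_loss X E W =
     1 / (2 * real (dim_row X)) * (frobenius_norm (attention W X - E))\<^sup>2"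

definition gradient :: "(real mat \<Rightarrow> real) \<Rightarrow> real mat \<Rightarrow> real mat" where
  "gradient L W = Matrix.mat (dim_row W) (dim_col W)
     (\<lambda>(j, m). deriv (\<lambda>s. L (update_mat W (j, m) s)) (W $$ (j, m)))"

definition approx_gradient_oracle ::
  "nat \<Rightarrow> nat \<Rightarrow> real \<Rightarrow> (real mat \<Rightarrow> real) \<Rightarrow> (real mat \<Rightarrow> real mat) \<Rightarrow> bool" where
  "approx_gradient_oracle d t \<delta> L G \<longleftrightarrow>
     (\<forall>W \<in> carrier_mat d t. G W \<in> carrier_mat d t \<and>
        (\<forall>j<d. \<forall>m<t. \<bar>G W $$ (j, m) - gradient L W $$ (j, m)\<bar> \<le> \<delta>))"

definition gradient_step ::
  "real \<Rightarrow> (real mat \<Rightarrow> real mat) \<Rightarrow> real mat \<Rightarrow> real mat" where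
  "gradient_step \<eta> G W = W - \<eta> \<cdot>\<^sub>m G W"

datatype gate = Noisy_AND | Noisy_OR

text \<open>The noiseless intermediate value of the OR problem is the complement of the
  product of the two bits, so it is negatively correlated with each of them, and a step
  size that makes the relevant weights grow has to be negative for \<open>Noisy_OR\<close>,
  while it is positive for \<open>Noisy_AND\<close>. Note that \<open>\<Theta>\<close> in the library constrains
  absolute values only.\<close>

fun gate_value :: "gate \<Rightarrow> real \<Rightarrow> real \<Rightarrow> real" where
  "gate_value Noisy_AND u v = u * v"
| "gate_value Noisy_OR u v = 1 - u * v"

definition boolean_cube :: "nat \<Rightarrow> real Matrix.vec set" where
  "boolean_cube d = {v \<in> carrier_vec d. \<forall>i<d. vec_index v i \<in> {0, 1}}"

text \<open>The randomness consists of \<open>n\<close> independent uniform inputs \<open>x\<close> and, independently of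
  them, one independent Bernoulli bit \<open>z (l, i)\<close> for each sample \<open>l\<close> and feature \<open>i\<close>,
  which is true with probability \<open>p\<close> and then flips that intermediate value.\<close>

type_synonym sample_data = "(nat \<Rightarrow> real Matrix.vec) \<times> (nat \<times> nat \<Rightarrow> bool)"

definition noisy_data :: "nat \<Rightarrow> nat \<Rightarrow> nat \<Rightarrow> real \<Rightarrow> sample_data pmf" where
  "noisy_data n d t p = pair_pmf
     (Pi_pmf {..<n} (0\<^sub>v d) (\<lambda>_. pmf_of_set (boolean_cube d)))
     (Pi_pmf ({..<n} \<times> {..<t}) False (\<lambda>_. bernoulli_pmf p))"

definition input_matrix :: "nat \<Rightarrow> nat \<Rightarrow> sample_data \<Rightarrow> real mat" where
  "input_matrix n d = (\<lambda>(x, z). Matrix.mat n d (\<lambda>(l, j). vec_index (x l) j))"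

text \<open>Here \<open>e\<close> enumerates the target subset as \<open>e 0, \<dots>, e (2 * t - 1)\<close>, and
  feature \<open>i\<close> combines the bits \<open>e (2 * i)\<close> and \<open>e (2 * i + 1)\<close>.\<close>

definition intermediate_matrix ::
  "gate \<Rightarrow> nat \<Rightarrow> nat \<Rightarrow> (nat \<Rightarrow> nat) \<Rightarrow> sample_data \<Rightarrow> real mat" where
  "intermediate_matrix g n t e = (\<lambda>(x, z). Matrix.mat n t (\<lambda>(l, i).
     let a = gate_value g (vec_index (x l) (e (2 * i))) (vec_index (x l) (e (2 * i + 1)))
     in if z (l, i) then 1 - a else a))"

definition data_loss ::
  "gate \<Rightarrow> nat \<Rightarrow> nat \<Rightarrow> nat \<Rightarrow> (nat \<Rightarrow> nat) \<Rightarrow> sample_data \<Rightarrow> real mat \<Rightarrow> real" where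
  "data_loss g n d t e \<omega> =
     surrogate_loss (input_matrix n d \<omega>) (intermediate_matrix g n t e \<omega>)"

definition \<phi> :: "real \<Rightarrow> nat \<Rightarrow> real \<Rightarrow> real" where
  "\<phi> \<epsilon> d x = (if x \<le> 0.5 * real d powr (\<epsilon> / 8) then 0 else 1)"

definition ones_vec :: "nat \<Rightarrow> real Matrix.vec" where
  "ones_vec t = Matrix.vec t (\<lambda>_. 1)"

definition indicator_vec :: "nat \<Rightarrow> nat set \<Rightarrow> real Matrix.vec" where
  "indicator_vec d b = Matrix.vec d (indicator b)"

end

theory Submission
  imports Defs "HOL-Real_Asymp.Real_Asymp"
begin

text \<open>At \<open>W = 0\<close> the softmax is uniform, so the \<open>(j, m)\<close> entry of the gradient is \<open>1 / d\<close> times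
  the empirical mean over the samples of \<open>(mean x - x'\<^sub>m) * (x\<^sub>j - mean x)\<close>. Only the correlation of
  \<open>x\<^sub>j\<close> with the noisy feature contributes to the expectation, which is \<open>\<plusminus>(1 - 2 * p) / 8\<close> up to
  \<open>O(1 / d)\<close> if \<open>j\<close> is one of the two inputs of feature \<open>m\<close> and \<open>O(1 / d)\<close> otherwise. As
  \<open>p \<le> 1 / 3\<close>, the gap between the two cases is a constant, so deviations of constant size are
  harmless; by Hoeffding's inequality and a union bound over the at most \<open>d\<^sup>2\<close> entries they occur
  with probability at most \<open>2 * d\<^sup>2 * exp (- n / 20000)\<close>. With \<open>\<eta> = \<plusminus>24 * d powr (1 + \<epsilon> / 8)\<close> the
  threshold then separates the two kinds of entries, and each element of the target subset is an
  input of exactly one feature.\<close>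

section \<open>The gradient of the surrogate loss at zero weights\<close>

definition bit_mean :: "nat \<Rightarrow> real Matrix.vec \<Rightarrow> real" where
  "bit_mean d v = (\<Sum>i<d. vec_index v i) / real d"

definition noisy_gate :: "gate \<Rightarrow> nat \<Rightarrow> nat \<Rightarrow> real Matrix.vec \<times> bool \<Rightarrow> real" where
  "noisy_gate g a b = (\<lambda>(v, z). let y = gate_value g (vec_index v a) (vec_index v b)
     in if z then 1 - y else y)"

text \<open>Contribution of one sample to \<open>d\<close> times the gradient entry in row
  \<open>j\<close> and the column of a feature with inputs \<open>a\<close> and \<open>b\<close>.
  Input and flip bit form one argument, so that the entry becomes an average of a fixed function of
  i.i.d. pairs.\<close>

definition gradient_sample ::
  "gate \<Rightarrow> nat \<Rightarrow> nat \<Rightarrow> nat \<Rightarrow> nat \<Rightarrow> real Matrix.vec \<times> bool \<Rightarrow> real" where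
  "gradient_sample g d a b j s =
     (bit_mean d (fst s) - noisy_gate g a b s) * (vec_index (fst s) j - bit_mean d (fst s))"

text \<open>The partial derivatives in \<open>gradient\<close> vary a single weight. Only column
  \<open>m\<close> of the softmax then depends on \<open>s\<close>, with relative weight
  \<open>exp s\<close> in row \<open>j\<close>; the other columns stay uniform and produce plain row
  means.\<close>

lemma attention_update_zero:
  assumes X: "X \<in> carrier_mat n d" and j: "j < d" and m: "m < t" and l: "l < n" and m': "m' < t"
  shows "attention (update_mat (0\<^sub>m d t) (j, m) s) X $$ (l, m') =
    (if m' = m then (\<Sum>i<d. X $$ (l, i) * (if i = j then exp s else 1)) /
                    (\<Sum>i<d. if i = j then exp s else 1)
     else (\<Sum>i<d. X $$ (l, i)) / real d)"
proof -
  have "update_mat (0\<^sub>m d t) (j, m) s $$ (i, m') = (if i = j \<and> m' = m then s else 0)" if "i < d" for i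
    using that m' by (auto simp: update_mat_def)
  hence *: "exp (update_mat (0\<^sub>m d t) (j, m) s $$ (i, m')) = (if m' = m \<and> i = j then exp s else 1)"
    if "i < d" for i using that by auto
  have "attention (update_mat (0\<^sub>m d t) (j, m) s) X $$ (l, m') =
     (\<Sum>i<d. X $$ (l, i) * ((if m' = m \<and> i = j then exp s else 1) /
                    (\<Sum>i<d. if m' = m \<and> i = j then exp s else 1)))"
    using X l m' by (simp add: attention_def softmax_def scalar_prod_def * lessThan_atLeast0)
  also have "\<dots> = (\<Sum>i<d. X $$ (l, i) * (if m' = m \<and> i = j then exp s else 1)) /
                    (\<Sum>i<d. if m' = m \<and> i = j then exp s else 1)"
    by (simp add: sum_divide_distrib)
  finally show ?thesis by (auto simp: cong: if_cong)
qed

text \<open>In column \<open>m\<close>, the derivative of the weighted mean of row \<open>l\<close>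
  at 0 is \<open>1 / d\<close> times the deviation of \<open>X $$ (l, j)\<close> from the row mean.
  The chain rule multiplies it by the residual, and the 2 from the square cancels the one in the
  loss.\<close>

lemma gradient_surrogate_loss_zero:
  assumes X: "X \<in> carrier_mat n d" and E: "E \<in> carrier_mat n t" and j: "j < d" and m: "m < t"
  shows "gradient (surrogate_loss X E) (0\<^sub>m d t) $$ (j, m) =
    (\<Sum>l<n. ((\<Sum>i<d. X $$ (l, i)) / real d - E $$ (l, m)) *
            (X $$ (l, j) - (\<Sum>i<d. X $$ (l, i)) / real d)) / (real n * real d)"
proof -
  \<comment> \<open>A closed form of the attention entries in the real variable \<open>s\<close>, so
    that no matrix operation has to be differentiated.\<close>
  define A where "A = (\<lambda>l m' s. if m' = m then (\<Sum>i<d. X $$ (l, i) * (if i = j then exp s else 1)) /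
                    (\<Sum>i<d. if i = j then exp s else (1::real))
     else (\<Sum>i<d. X $$ (l, i)) / real d)"
  define xb where "xb = (\<lambda>l. (\<Sum>i<d. X $$ (l, i)) / real d)"
  have d: "d > 0" using j by simp
  have loss: "surrogate_loss X E (update_mat (0\<^sub>m d t) (j, m) s) =
     1 / (2 * real n) * (\<Sum>l<n. \<Sum>m'<t. (A l m' s - E $$ (l, m'))\<^sup>2)" for s
  proof -
    have "(frobenius_norm (attention (update_mat (0\<^sub>m d t) (j, m) s) X - E))\<^sup>2 =
       (\<Sum>l<n. \<Sum>m'<t. ((attention (update_mat (0\<^sub>m d t) (j, m) s) X - E) $$ (l, m'))\<^sup>2)"
      using X E by (simp add: frobenius_norm_def sum_nonneg attention_def softmax_def)
    also have "\<dots> = (\<Sum>l<n. \<Sum>m'<t. (A l m' s - E $$ (l, m'))\<^sup>2)"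
    proof (intro sum.cong refl)
      fix l m' assume "l \<in> {..<n}" "m' \<in> {..<t}"
      thus "((attention (update_mat (0\<^sub>m d t) (j, m) s) X - E) $$ (l, m'))\<^sup>2 =
            (A l m' s - E $$ (l, m'))\<^sup>2"
        using attention_update_zero[OF X j m, of l m' s] X E by (simp add: A_def)
    qed
    finally show ?thesis using X by (simp add: surrogate_loss_def)
  qed
  have dA: "(A l m' has_field_derivative (if m' = m then (X $$ (l, j) - xb l) / real d else 0)) (at 0)" for l m'
  proof (cases "m' = m")
    case True
    have e: "((\<lambda>s. if i = j then exp s else 1) has_field_derivative (if i = j then 1 else 0)) (at (0::real))" for i
      by (cases "i = j") (auto intro!: derivative_eq_intros)
    have N: "((\<lambda>s. \<Sum>i<d. X $$ (l, i) * (if i = j then exp s else 1)) has_field_derivative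
           (\<Sum>i<d. X $$ (l, i) * (if i = j then 1 else 0))) (at (0::real))"
      by (intro DERIV_sum DERIV_cmult e)
    have D: "((\<lambda>s. \<Sum>i<d. (if i = j then exp s else 1)) has_field_derivative
           (\<Sum>i<d. (if i = j then 1 else 0))) (at (0::real))"
      by (intro DERIV_sum e)
    have pick: "(\<Sum>i<d. X $$ (l, i) * (if i = j then 1 else 0)) = X $$ (l, j)"
      using j by (simp add: if_distrib[of "(*) _"] cong: if_cong)
    have "A l m' = (\<lambda>s. (\<Sum>i<d. X $$ (l, i) * (if i = j then exp s else 1)) /
                    (\<Sum>i<d. if i = j then exp s else (1::real)))"
      using True by (simp add: A_def)
    \<comment> \<open>Quotient rule: at 0 the denominator is \<open>d\<close> with derivative 1, the
      numerator \<open>d * xb l\<close> with derivative \<open>X $$ (l, j)\<close>.\<close>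
    moreover have "((\<lambda>s. (\<Sum>i<d. X $$ (l, i) * (if i = j then exp s else 1)) /
                    (\<Sum>i<d. if i = j then exp s else (1::real))) has_field_derivative
        ((X $$ (l, j) - xb l) / real d)) (at 0)"
      by (rule DERIV_cong[OF DERIV_divide[OF N D]])
         (use d j in \<open>simp_all add: pick xb_def field_simps cong: if_cong\<close>)
    ultimately show ?thesis using True by simp
  qed (simp add: A_def)
  have A0: "A l m 0 = xb l" for l
    by (simp add: A_def xb_def cong: if_cong)
  have sq: "((\<lambda>s. (A l m' s - c)\<^sup>2) has_field_derivative
      (if m' = m then 2 * (xb l - c) * ((X $$ (l, j) - xb l) / real d) else 0)) (at 0)" for l m' c
    by (rule derivative_eq_intros dA refl)+ (auto simp: A0)
  have "((\<lambda>s. surrogate_loss X E (update_mat (0\<^sub>m d t) (j, m) s)) has_field_derivative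
      1 / (2 * real n) * (\<Sum>l<n. \<Sum>m'<t. if m' = m then 2 * (xb l - E $$ (l, m')) * ((X $$ (l, j) - xb l) / real d) else 0)) (at 0)"
    unfolding loss by (intro DERIV_cmult DERIV_sum sq)
  from DERIV_imp_deriv[OF this] have "gradient (surrogate_loss X E) (0\<^sub>m d t) $$ (j, m) =
      1 / (2 * real n) * (\<Sum>l<n. 2 * (xb l - E $$ (l, m)) * ((X $$ (l, j) - xb l) / real d))"
    using j m by (simp add: gradient_def)
  also have "\<dots> = (\<Sum>l<n. (xb l - E $$ (l, m)) * (X $$ (l, j) - xb l)) / (real n * real d)"
    unfolding sum_distrib_left sum_divide_distrib
    by (intro sum.cong) (simp_all del: right_diff_distrib_numeral)
  finally show ?thesis by (simp add: xb_def)
qed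

section \<open>Moments of uniformly random bits\<close>

lemma boolean_cube_altdef: "boolean_cube d = Matrix.vec d ` PiE_dflt {..<d} 0 (\<lambda>_. {0, 1})"
proof (intro equalityI subsetI)
  fix v assume v: "v \<in> boolean_cube d"
  let ?f = "\<lambda>i. if i < d then vec_index v i else 0"
  have "v = Matrix.vec d ?f" using v by (intro eq_vecI) (auto simp: boolean_cube_def)
  moreover have "?f \<in> PiE_dflt {..<d} 0 (\<lambda>_. {0, 1})"
    using v by (auto simp: boolean_cube_def PiE_dflt_def)
  ultimately show "v \<in> Matrix.vec d ` PiE_dflt {..<d} 0 (\<lambda>_. {0, 1})" by blast
qed (auto simp: boolean_cube_def PiE_dflt_def)

lemma finite_boolean_cube [simp]: "finite (boolean_cube d)"
  unfolding boolean_cube_altdef by (intro finite_imageI finite_PiE_dflt) auto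

lemma boolean_cube_nonempty [simp]: "boolean_cube d \<noteq> {}"
  unfolding boolean_cube_altdef by auto

text \<open>This exhibits the coordinates as independent fair bits. The default 0 outside
  \<open>{..<d}\<close> makes \<open>Matrix.vec d\<close> injective on the functions involved, so it
  carries the uniform distribution to the uniform distribution.\<close>

lemma uniform_boolean_cube_altdef:
  "pmf_of_set (boolean_cube d) =
     map_pmf (Matrix.vec d) (Pi_pmf {..<d} 0 (\<lambda>_. pmf_of_set {0, 1}))"
proof -
  have inj: "inj_on (Matrix.vec d) (PiE_dflt {..<d} 0 (\<lambda>_. {0, 1 :: real}))"
  proof (intro inj_onI ext)
    fix f h :: "nat \<Rightarrow> real" and i
    assume *: "f \<in> PiE_dflt {..<d} 0 (\<lambda>_. {0, 1})" "h \<in> PiE_dflt {..<d} 0 (\<lambda>_. {0, 1})"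
      "Matrix.vec d f = Matrix.vec d h"
    from *(3) have "vec_index (Matrix.vec d f) i = vec_index (Matrix.vec d h) i" by simp
    with *(1,2) show "f i = h i" by (cases "i < d") (auto simp: PiE_dflt_def)
  qed
  have "Pi_pmf {..<d} 0 (\<lambda>_. pmf_of_set {0, 1 :: real}) = pmf_of_set (PiE_dflt {..<d} 0 (\<lambda>_. {0, 1}))"
    by (intro Pi_pmf_of_set) auto
  thus ?thesis
    by (simp add: map_pmf_of_set_inj[OF inj] finite_PiE_dflt boolean_cube_altdef)
qed

lemma expectation_prod_boolean_cube:
  assumes "S \<subseteq> {..<d}"
  shows "measure_pmf.expectation (pmf_of_set (boolean_cube d)) (\<lambda>v. \<Prod>i\<in>S. vec_index v i) = (1 / 2) ^ card S"
proof -
  have "measure_pmf.expectation (pmf_of_set (boolean_cube d)) (\<lambda>v. \<Prod>i\<in>S. vec_index v i) =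
    measure_pmf.expectation (Pi_pmf {..<d} 0 (\<lambda>_. pmf_of_set {0, 1})) (\<lambda>f. \<Prod>i\<in>S. f i)"
    unfolding uniform_boolean_cube_altdef integral_map_pmf
    by (intro Bochner_Integration.integral_cong prod.cong refl) (use assms in auto)
  \<comment> \<open>Factors outside \<open>S\<close> become 1, so that the product runs over the
    whole index set of the \<open>Pi_pmf\<close>.\<close>
  also have "\<dots> = measure_pmf.expectation (Pi_pmf {..<d} 0 (\<lambda>_. pmf_of_set {0, 1}))
    (\<lambda>f. \<Prod>i<d. if i \<in> S then f i else 1)"
    using assms by (simp add: prod.If_cases Int_absorb1 Int_absorb2)
  also have "\<dots> = (\<Prod>i<d. measure_pmf.expectation (pmf_of_set {0, 1}) (\<lambda>x. if i \<in> S then x else 1))"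
    by (rule expectation_prod_Pi_pmf) (auto intro!: integrable_measure_pmf_finite)
  also have "\<dots> = (\<Prod>i<d. if i \<in> S then 1 / 2 else 1)"
    by (intro prod.cong refl) (auto simp: integral_pmf_of_set)
  also have "\<dots> = (1 / 2) ^ card S"
    using assms by (simp add: prod.If_cases Int_absorb1 Int_absorb2)
  finally show ?thesis .
qed

lemma set_pmf_of_boolean_cube [simp]: "set_pmf (pmf_of_set (boolean_cube d)) = boolean_cube d"
  by (intro set_pmf_of_set) auto

text \<open>Bits are idempotent, so repeated indices collapse to a product over a set. One formula
  thus covers all coincidences of indices, and shorter products follow by repeating an
  index.\<close>

lemma expectation_triple_boolean_cube:
  assumes "i < d" "j < d" "k < d"
  shows "measure_pmf.expectation (pmf_of_set (boolean_cube d))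
           (\<lambda>v. vec_index v i * vec_index v j * vec_index v k) = (1 / 2) ^ card {i, j, k}"
proof -
  have "measure_pmf.expectation (pmf_of_set (boolean_cube d))
           (\<lambda>v. vec_index v i * vec_index v j * vec_index v k) =
        measure_pmf.expectation (pmf_of_set (boolean_cube d)) (\<lambda>v. \<Prod>l\<in>{i, j, k}. vec_index v l)"
  proof (intro integral_cong_AE)
    show "AE v in measure_pmf (pmf_of_set (boolean_cube d)).
        vec_index v i * vec_index v j * vec_index v k = (\<Prod>l\<in>{i, j, k}. vec_index v l)"
    proof (unfold AE_measure_pmf_iff, intro ballI)
      fix v assume "v \<in> set_pmf (pmf_of_set (boolean_cube d))"
      hence "v \<in> boolean_cube d" by simp
      hence "vec_index v i \<in> {0, 1}" "vec_index v j \<in> {0, 1}" "vec_index v k \<in> {0, 1}"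
        using assms by (auto simp: boolean_cube_def)
      thus "vec_index v i * vec_index v j * vec_index v k = (\<Prod>l\<in>{i, j, k}. vec_index v l)"
        by (auto simp: prod.insert_if)
    qed
  qed auto
  also have "\<dots> = (1 / 2) ^ card {i, j, k}"
    using assms by (intro expectation_prod_boolean_cube) auto
  finally show ?thesis .
qed

section \<open>The expected contribution of one sample\<close>

lemma expectation_pair_bernoulli_pmf:
  fixes f :: "'a \<times> bool \<Rightarrow> real"
  assumes "finite (set_pmf P)" "p \<in> {0..1}"
  shows "measure_pmf.expectation (pair_pmf P (bernoulli_pmf p)) f =
    p * measure_pmf.expectation P (\<lambda>v. f (v, True)) +
    (1 - p) * measure_pmf.expectation P (\<lambda>v. f (v, False))"
proof -
  \<comment> \<open>Drawing the flip bit first turns the expectation into a mixture of two.\<close>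
  have "pair_pmf P (bernoulli_pmf p) = bernoulli_pmf p \<bind> (\<lambda>z. map_pmf (\<lambda>v. (v, z)) P)"
    unfolding pair_pmf_def map_pmf_def by (rule bind_commute_pmf)
  hence "measure_pmf.expectation (pair_pmf P (bernoulli_pmf p)) f =
      (\<Sum>z\<in>UNIV. pmf (bernoulli_pmf p) z *\<^sub>R measure_pmf.expectation (map_pmf (\<lambda>v. (v, z)) P) f)"
    using assms(1) by (simp only:) (rule pmf_expectation_bind, auto)
  thus ?thesis using assms(2) by (simp add: UNIV_bool)
qed

text \<open>The coefficient of \<open>u * v\<close> in \<open>gate_value g u v\<close>, hence the
  sign of the correlation of the noiseless feature with its inputs. It also fixes the sign of the
  step size.\<close>

definition gate_sign :: "gate \<Rightarrow> real" where
  "gate_sign g = (case g of Noisy_AND \<Rightarrow> 1 | Noisy_OR \<Rightarrow> - 1)"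

text \<open>The term \<open>bit_mean * (x_j - bit_mean)\<close> has expectation 0 by symmetry among
  the coordinates, and constants vanish against the centred factor. What remains is the product of
  the two input bits: its moment with \<open>x_j\<close> is 1/4 or 1/8, and with the mean it is
  \<open>1 / 8 + 1 / (4 * d)\<close>. A flip reverses the sign, which yields the factor
  \<open>1 - 2 * p\<close>.\<close>

lemma expectation_gradient_sample:
  assumes "a < d" "b < d" "a \<noteq> b" "j < d" "p \<in> {0..1}"
  shows "measure_pmf.expectation (pair_pmf (pmf_of_set (boolean_cube d)) (bernoulli_pmf p))
           (gradient_sample g d a b j) =
         - gate_sign g * (1 - 2 * p) * ((if j \<in> {a, b} then 1 / 8 else 0) - 1 / (4 * real d))"
proof -
  define U where "U = pmf_of_set (boolean_cube d)"
  define Ex :: "(real Matrix.vec \<Rightarrow> real) \<Rightarrow> real" where "Ex = measure_pmf.expectation U"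
  have d: "d > 0" using assms by simp
  have fin: "finite (set_pmf U)" by (simp add: U_def)
  have int [simp]: "integrable (measure_pmf U) f" for f :: "_ \<Rightarrow> real"
    by (intro integrable_measure_pmf_finite fin)
  have E3: "Ex (\<lambda>v. vec_index v i * vec_index v j * vec_index v k) = (1 / 2) ^ card {i, j, k}"
    if "i < d" "j < d" "k < d" for i j k
    using expectation_triple_boolean_cube[OF that] by (simp add: Ex_def U_def)
  have AE_U: "vec_index v i = 0 \<or> vec_index v i = 1" if "v \<in> set_pmf U" "i < d" for v i
  proof -
    have "v \<in> boolean_cube d" using that by (simp add: U_def)
    thus ?thesis using that by (auto simp: boolean_cube_def)
  qed
  have Econg: "Ex f = Ex h" if "\<And>v. v \<in> set_pmf U \<Longrightarrow> f v = h v" for f h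
    unfolding Ex_def by (intro integral_cong_AE) (auto simp: AE_measure_pmf_iff that)
  have E1: "Ex (\<lambda>v. vec_index v i) = 1 / 2" if "i < d" for i
    using E3[of i i i] that Econg[of "\<lambda>v. vec_index v i" "\<lambda>v. vec_index v i * vec_index v i * vec_index v i"]
    by (force dest: AE_U)
  have E2: "Ex (\<lambda>v. vec_index v i * vec_index v j) = (if i = j then 1 / 2 else 1 / 4)"
    if "i < d" "j < d" for i j
    using E3[of i i j] that Econg[of "\<lambda>v. vec_index v i * vec_index v j" "\<lambda>v. vec_index v i * vec_index v i * vec_index v j"]
    by (force dest: AE_U simp: power2_eq_square)
  have Esum: "Ex (\<lambda>v. \<Sum>i<d. f i v) = (\<Sum>i<d. Ex (f i))" for f :: "nat \<Rightarrow> _ \<Rightarrow> real"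
    unfolding Ex_def by (intro Bochner_Integration.integral_sum) auto
  have Eadd: "Ex (\<lambda>v. f v + h v) = Ex f + Ex h" for f h unfolding Ex_def by simp
  have Ediff: "Ex (\<lambda>v. f v - h v) = Ex f - Ex h" for f h unfolding Ex_def by simp
  have Ecmult: "Ex (\<lambda>v. c * f v) = c * Ex f" for f c unfolding Ex_def by simp
  have Ediv: "Ex (\<lambda>v. f v / c) = Ex f / c" for f c unfolding Ex_def by simp
  have sum_if: "(\<Sum>i<d. if i = l then x else y) = x + (real d - 1) * y" if "l < d" for l and x y :: real
    using that d by (subst sum.remove[of _ l]) (auto simp: of_nat_diff)
  have mean: "Ex (\<lambda>v. vec_index v j - bit_mean d v) = 0"
    using assms d by (simp add: bit_mean_def Ediff Ediv Esum E1)
  \<comment> \<open>The value is the same for every \<open>l\<close>, so averaging over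
    \<open>l\<close> gives the second moment of the mean, and \<open>xx\<close> follows.\<close>
  have xj: "Ex (\<lambda>v. bit_mean d v * vec_index v l) = (1 / 2 + (real d - 1) / 4) / real d" if "l < d" for l
    using that by (simp add: bit_mean_def Ediv Esum sum_distrib_right E2 sum_if)
  have "Ex (\<lambda>v. bit_mean d v * bit_mean d v) = (\<Sum>l<d. Ex (\<lambda>v. bit_mean d v * vec_index v l)) / real d"
    by (subst (2) bit_mean_def) (simp add: Ediv Esum sum_distrib_left)
  also have "\<dots> = (1 / 2 + (real d - 1) / 4) / real d"
    using d by (simp add: xj)
  finally have xx: "Ex (\<lambda>v. bit_mean d v * (vec_index v j - bit_mean d v)) = 0"
    using assms by (simp add: right_diff_distrib Ediff xj)
  define q where "q = (\<lambda>l. if l \<in> {a, b} then 1 / 4 else 1 / 8 :: real)"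
  have q: "Ex (\<lambda>v. vec_index v a * vec_index v b * vec_index v l) = q l" if "l < d" for l
    using assms that by (subst E3) (auto simp: q_def card_insert_if power2_eq_square power3_eq_cube)
  have "(\<Sum>l<d. q l) = (\<Sum>l\<in>{..<d}-{a,b}. q l) + (\<Sum>l\<in>{a,b}. q l)"
    using assms by (intro sum.subset_diff) auto
  also have "(\<Sum>l\<in>{..<d}-{a,b}. q l) = (\<Sum>l\<in>{..<d}-{a,b}. 1 / 8)"
    by (intro sum.cong) (auto simp: q_def)
  also have "\<dots> = (real d - 2) / 8"
    using assms by (simp add: card_Diff_subset of_nat_diff)
  finally have "(\<Sum>l<d. q l) = 1 / 2 + (real d - 2) / 8"
    using assms by (simp add: q_def)
  hence "Ex (\<lambda>v. vec_index v a * vec_index v b * bit_mean d v) = (1 / 2 + (real d - 2) / 8) / real d"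
    by (simp add: bit_mean_def Ediv Esum sum_distrib_left q)
  hence ab: "Ex (\<lambda>v. vec_index v a * vec_index v b * (vec_index v j - bit_mean d v)) =
     (if j \<in> {a, b} then 1 / 8 else 0) - 1 / (4 * real d)"
    using assms d by (simp add: right_diff_distrib Ediff q) (simp add: q_def field_simps)
  \<comment> \<open>Either gate, flipped or not, has the form \<open>c + s * (x_a * x_b)\<close>
    with \<open>(c, s)\<close> equal to \<open>(0, 1)\<close> or \<open>(1, -1)\<close>.\<close>
  have gen: "Ex (\<lambda>v. (bit_mean d v - (c + s * (vec_index v a * vec_index v b))) * (vec_index v j - bit_mean d v)) =
     - s * ((if j \<in> {a, b} then 1 / 8 else 0) - 1 / (4 * real d))" for c s
  proof -
    have "(\<lambda>v. (bit_mean d v - (c + s * (vec_index v a * vec_index v b))) * (vec_index v j - bit_mean d v)) =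
      (\<lambda>v. bit_mean d v * (vec_index v j - bit_mean d v) - (c * (vec_index v j - bit_mean d v) +
          s * (vec_index v a * vec_index v b * (vec_index v j - bit_mean d v))))"
      by (simp add: fun_eq_iff algebra_simps)
    thus ?thesis by (simp only: Ediff[of "\<lambda>v. bit_mean d v * (vec_index v j - bit_mean d v)"]
        Eadd Ecmult xx mean ab)
  qed
  have "measure_pmf.expectation (pair_pmf U (bernoulli_pmf p)) (gradient_sample g d a b j) =
    p * Ex (\<lambda>v. gradient_sample g d a b j (v, True)) + (1 - p) * Ex (\<lambda>v. gradient_sample g d a b j (v, False))"
    unfolding Ex_def by (rule expectation_pair_bernoulli_pmf[OF fin]) (use assms in auto)
  also have "\<dots> = - gate_sign g * (1 - 2 * p) * ((if j \<in> {a, b} then 1 / 8 else 0) - 1 / (4 * real d))"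
  proof -
    define K where "K = (if j \<in> {a, b} then 1 / 8 else 0) - 1 / (4 * real d)"
    have "Ex (\<lambda>v. (bit_mean d v - vec_index v a * vec_index v b) * (vec_index v j - bit_mean d v)) = - K"
      "Ex (\<lambda>v. (bit_mean d v - (1 - vec_index v a * vec_index v b)) * (vec_index v j - bit_mean d v)) = K"
      using gen[of 0 1] gen[of 1 "-1"] by (simp_all add: K_def)
    hence "p * Ex (\<lambda>v. gradient_sample g d a b j (v, True)) + (1 - p) * Ex (\<lambda>v. gradient_sample g d a b j (v, False)) =
        (case g of Noisy_AND \<Rightarrow> p * K + (1 - p) * (- K) | Noisy_OR \<Rightarrow> p * (- K) + (1 - p) * K)"
      by (cases g) (simp_all add: gradient_sample_def noisy_gate_def)
    also have "\<dots> = - gate_sign g * (1 - 2 * p) * K"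
      by (cases g) (simp_all add: gate_sign_def algebra_simps)
    finally show ?thesis by (simp only: K_def)
  qed
  finally show ?thesis by (simp add: U_def)
qed

section \<open>Independence of the samples within one column\<close>

text \<open>Both mass functions factor over \<open>A\<close> into the same terms. A function that
  differs from the default pair outside \<open>A\<close> does so in some component and has mass 0 on
  both sides.\<close>

lemma Pi_pmf_pair:
  assumes "finite A"
  shows "Pi_pmf A (x, y) (\<lambda>i. pair_pmf (P i) (Q i)) =
    map_pmf (\<lambda>(f, h) i. (f i, h i)) (pair_pmf (Pi_pmf A x P) (Pi_pmf A y Q))"
proof (rule pmf_eqI)
  fix h :: "'a \<Rightarrow> 'b \<times> 'c"
  let ?F = "\<lambda>(f, h) i. (f i, h i) :: 'b \<times> 'c"
  have inj: "inj ?F" by (auto simp: inj_def fun_eq_iff)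
  have h: "h = ?F (fst \<circ> h, snd \<circ> h)" by auto
  have "pmf (map_pmf ?F (pair_pmf (Pi_pmf A x P) (Pi_pmf A y Q))) h =
      pmf (Pi_pmf A x P) (fst \<circ> h) * pmf (Pi_pmf A y Q) (snd \<circ> h)"
    by (subst h, subst pmf_map_inj'[OF inj]) (simp add: pmf_pair)
  also have "\<dots> = pmf (Pi_pmf A (x, y) (\<lambda>i. pair_pmf (P i) (Q i))) h"
  proof (cases "\<forall>i. i \<notin> A \<longrightarrow> h i = (x, y)")
    case True
    moreover have "pmf (pair_pmf (P i) (Q i)) (h i) = pmf (P i) (fst (h i)) * pmf (Q i) (snd (h i))" for i
      by (cases "h i") (simp add: pmf_pair)
    ultimately show ?thesis
      using assms by (simp add: pmf_Pi' prod.distrib)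
  next
    case False
    then obtain i where "i \<notin> A" "h i \<noteq> (x, y)" by blast
    hence "i \<notin> A \<and> (fst \<circ> h) i \<noteq> x \<or> i \<notin> A \<and> (snd \<circ> h) i \<noteq> y"
      by (cases "h i") auto
    with assms have "pmf (Pi_pmf A x P) (fst \<circ> h) = 0 \<or> pmf (Pi_pmf A y Q) (snd \<circ> h) = 0"
      using pmf_Pi_outside[of A "fst \<circ> h" x P] pmf_Pi_outside[of A "snd \<circ> h" y Q] by blast
    moreover have "pmf (Pi_pmf A (x, y) (\<lambda>i. pair_pmf (P i) (Q i))) h = 0"
      using False assms by (intro pmf_Pi_outside) auto
    ultimately show ?thesis by auto
  qed
  finally show "pmf (Pi_pmf A (x, y) (\<lambda>i. pair_pmf (P i) (Q i))) h =
      pmf (map_pmf ?F (pair_pmf (Pi_pmf A x P) (Pi_pmf A y Q))) h" by simp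
qed

text \<open>Restricting a product distribution to the indices of one column leaves a product
  distribution, which is then reindexed by the sample number.\<close>

lemma Pi_pmf_column:
  fixes n t :: nat
  assumes "m < t"
  shows "map_pmf (\<lambda>z l. z (l, m)) (Pi_pmf ({..<n} \<times> {..<t}) dflt (\<lambda>_. P)) =
    Pi_pmf {..<n} dflt (\<lambda>_. P)"
proof -
  have "Pi_pmf {..<n} dflt (\<lambda>_. P) =
      map_pmf (\<lambda>g. g \<circ> (\<lambda>l. (l, m))) (Pi_pmf ({..<n} \<times> {m}) dflt (\<lambda>_. P))"
    by (rule Pi_pmf_bij_betw) (auto intro!: bij_betwI[where g = fst])
  also have "Pi_pmf ({..<n} \<times> {m}) dflt (\<lambda>_. P) =
      map_pmf (\<lambda>f x. if x \<in> {..<n} \<times> {m} then f x else dflt) (Pi_pmf ({..<n} \<times> {..<t}) dflt (\<lambda>_. P))"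
    by (rule Pi_pmf_subset) (use assms in auto)
  finally have "Pi_pmf {..<n} dflt (\<lambda>_. P) =
      map_pmf ((\<lambda>g. g \<circ> (\<lambda>l. (l, m))) \<circ> (\<lambda>f x. if x \<in> {..<n} \<times> {m} then f x else dflt))
        (Pi_pmf ({..<n} \<times> {..<t}) dflt (\<lambda>_. P))"
    by (simp only: pmf.map_comp)
  also have "\<dots> = map_pmf (\<lambda>z l. z (l, m)) (Pi_pmf ({..<n} \<times> {..<t}) dflt (\<lambda>_. P))"
  proof (intro map_pmf_cong refl ext)
    fix z :: "nat \<times> nat \<Rightarrow> 'a" and l
    assume "z \<in> set_pmf (Pi_pmf ({..<n} \<times> {..<t}) dflt (\<lambda>_. P))"
    \<comment> \<open>The equality concerns functions on all of \<open>nat\<close>: beyond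
      \<open>n\<close> the original bits already equal the default, so truncation changes
      nothing.\<close>
    hence "z (l, m) = dflt" if "l \<ge> n"
      using that set_Pi_pmf_subset[of "{..<n} \<times> {..<t}" dflt "\<lambda>_. P"] by auto
    thus "((\<lambda>g. g \<circ> (\<lambda>l. (l, m))) \<circ> (\<lambda>f x. if x \<in> {..<n} \<times> {m} then f x else dflt)) z l = z (l, m)"
      by (cases "l < n") auto
  qed
  finally show ?thesis by simp
qed

text \<open>Distinct columns share the inputs and are dependent, but within one column the samples
  are i.i.d. pairs. Concentration is therefore applied to each column separately.\<close>

lemma noisy_data_column:
  assumes "m < t"
  shows "map_pmf (\<lambda>(x, z) l. (x l, z (l, m))) (noisy_data n d t p) =
    Pi_pmf {..<n} (0\<^sub>v d, False) (\<lambda>_. pair_pmf (pmf_of_set (boolean_cube d)) (bernoulli_pmf p))"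
proof -
  have "pair_pmf (Pi_pmf {..<n} (0\<^sub>v d) (\<lambda>_. pmf_of_set (boolean_cube d))) (Pi_pmf {..<n} False (\<lambda>_. bernoulli_pmf p)) =
    map_pmf (\<lambda>(x, z). (x, \<lambda>l. z (l, m))) (noisy_data n d t p)"
    using Pi_pmf_column[OF assms, of n False "bernoulli_pmf p"]
    by (simp add: noisy_data_def map_pair)
  thus ?thesis
    by (simp add: Pi_pmf_pair pmf.map_comp o_def case_prod_unfold)
qed

section \<open>Concentration of the gradient entries\<close>

lemma Pi_pmf_Hoeffding:
  fixes f :: "'a \<Rightarrow> real"
  assumes "n > 0" "\<And>s. s \<in> set_pmf P \<Longrightarrow> \<bar>f s\<bar> \<le> 1" "\<tau> \<ge> 0"
  shows "measure_pmf.prob (Pi_pmf {..<n} dflt (\<lambda>_. P))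
      {h. \<bar>(\<Sum>l<n. f (h l)) / real n - measure_pmf.expectation P f\<bar> \<ge> \<tau>}
    \<le> 2 * exp (- real n * \<tau>\<^sup>2 / 2)"
proof -
  let ?M = "Pi_pmf {..<n} dflt (\<lambda>_. P)"
  have comp: "map_pmf (\<lambda>h. h l) ?M = P" if "l < n" for l
    using that by (simp add: Pi_pmf_component)
  have ex: "measure_pmf.expectation ?M (\<lambda>h. f (h l)) = measure_pmf.expectation P f" if "l < n" for l
    using integral_map_pmf[of "\<lambda>h. h l" ?M f] comp[OF that] by simp
  interpret Hoeffding_ineq "measure_pmf ?M" "{..<n}" "\<lambda>l h. f (h l)" "\<lambda>_. -1" "\<lambda>_. 1"
     "real n * measure_pmf.expectation P f"
  proof unfold_locales
    show "prob_space.indep_vars (measure_pmf ?M) (\<lambda>_. borel) (\<lambda>l h. f (h l)) {..<n}"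
      using prob_space.indep_vars_compose2[OF prob_space_measure_pmf indep_vars_Pi_pmf, of "{..<n}" "\<lambda>_. f" "\<lambda>_. borel" dflt "\<lambda>_. P"]
      by simp
  next
    fix l assume "l \<in> {..<n}"
    hence "set_pmf P = (\<lambda>h. h l) ` set_pmf ?M"
      using comp[of l] by (metis lessThan_iff set_map_pmf)
    thus "AE h in measure_pmf ?M. f (h l) \<in> {-1..1}"
      using assms(2) by (force simp: AE_measure_pmf_iff abs_le_iff)
  qed (use ex in auto)
  have "{h. \<bar>(\<Sum>l<n. f (h l)) / real n - measure_pmf.expectation P f\<bar> \<ge> \<tau>} =
    {h. \<bar>(\<Sum>l<n. f (h l)) - real n * measure_pmf.expectation P f\<bar> \<ge> real n * \<tau>}" (is "_ = ?R")
  proof (intro Collect_cong)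
    fix h
    have "(\<Sum>l<n. f (h l)) - real n * measure_pmf.expectation P f =
       real n * ((\<Sum>l<n. f (h l)) / real n - measure_pmf.expectation P f)"
      using assms(1) by (simp add: field_simps)
    thus "(\<tau> \<le> \<bar>(\<Sum>l<n. f (h l)) / real n - measure_pmf.expectation P f\<bar>) =
       (real n * \<tau> \<le> \<bar>(\<Sum>l<n. f (h l)) - real n * measure_pmf.expectation P f\<bar>)"
      using assms(1) by (simp add: abs_mult)
  qed
  also have "measure_pmf.prob ?M ?R \<le> 2 * exp (-2 * (real n * \<tau>)\<^sup>2 / (\<Sum>l<n. (1 - (-1))\<^sup>2))"
    using Hoeffding_ineq_abs_ge[of "real n * \<tau>"] assms by simp
  \<comment> \<open>Each summand ranges over an interval of length 2, so the denominator is
    \<open>4 * n\<close>.\<close>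
  also have "-2 * (real n * \<tau>)\<^sup>2 / (\<Sum>l<n. (1 - (-1))\<^sup>2) = - real n * \<tau>\<^sup>2 / 2"
    using assms(1) by (simp add: field_simps power2_eq_square)
  finally show ?thesis .
qed

definition column_data :: "nat \<Rightarrow> sample_data \<Rightarrow> nat \<Rightarrow> real Matrix.vec \<times> bool" where
  "column_data m = (\<lambda>(x, z) l. (x l, z (l, m)))"

lemma gradient_data_loss_zero:
  assumes "j < d" "m < t"
  shows "gradient (data_loss g n d t e \<omega>) (0\<^sub>m d t) $$ (j, m) =
    (\<Sum>l<n. gradient_sample g d (e (2 * m)) (e (2 * m + 1)) j (column_data m \<omega> l)) / real n / real d"
proof -
  obtain x z where \<omega>: "\<omega> = (x, z)" by (cases \<omega>)
  have "input_matrix n d \<omega> \<in> carrier_mat n d" "intermediate_matrix g n t e \<omega> \<in> carrier_mat n t"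
    by (simp_all add: \<omega> input_matrix_def intermediate_matrix_def)
  from gradient_surrogate_loss_zero[OF this assms] show ?thesis
    using assms
    by (simp add: data_loss_def \<omega> input_matrix_def intermediate_matrix_def gradient_sample_def
        column_data_def bit_mean_def noisy_gate_def Let_def cong: if_cong)
qed

text \<open>Each of the two factors is a difference of numbers in \<open>{0..1}\<close>.\<close>

lemma abs_gradient_sample_le_1:
  assumes "a < d" "b < d" "j < d" "v \<in> boolean_cube d"
  shows "\<bar>gradient_sample g d a b j (v, z)\<bar> \<le> 1"
proof -
  have bit: "vec_index v i = 0 \<or> vec_index v i = 1" if "i < d" for i
    using assms(4) that by (auto simp: boolean_cube_def)
  have bit': "0 \<le> vec_index v i" "vec_index v i \<le> 1" if "i < d" for i
    using bit[OF that] by auto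
  have "0 \<le> (\<Sum>i<d. vec_index v i)" "(\<Sum>i<d. vec_index v i) \<le> real d"
    using sum_mono[of "{..<d}" "vec_index v" "\<lambda>_. 1"] by (auto intro!: sum_nonneg bit')
  hence mean: "0 \<le> bit_mean d v" "bit_mean d v \<le> 1"
    using assms by (auto simp: bit_mean_def divide_le_eq_1)
  have gate: "0 \<le> noisy_gate g a b (v, z)" "noisy_gate g a b (v, z) \<le> 1"
    using bit[of a] bit[of b] assms by (cases g; auto simp: noisy_gate_def)+
  have "\<bar>bit_mean d v - noisy_gate g a b (v, z)\<bar> * \<bar>vec_index v j - bit_mean d v\<bar> \<le> 1 * 1"
    using mean gate bit'[OF assms(3)] by (intro mult_mono) auto
  thus ?thesis by (simp add: gradient_sample_def abs_mult)
qed

text \<open>The plus sign before \<open>gate_sign g\<close> comes from subtracting an expectation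
  that itself carries a minus.\<close>

lemma gradient_concentration:
  fixes d :: nat
  assumes "n > 0" "m < t" "a < d" "b < d" "a \<noteq> b" "j < d" "p \<in> {0..1}" "\<tau> \<ge> 0"
  shows "measure_pmf.prob (noisy_data n d t p)
     {\<omega>. \<bar>(\<Sum>l<n. gradient_sample g d a b j (column_data m \<omega> l)) / real n +
        gate_sign g * (1 - 2 * p) * ((if j \<in> {a, b} then 1 / 8 else 0) - 1 / (4 * real d))\<bar> \<ge> \<tau>}
     \<le> 2 * exp (- real n * \<tau>\<^sup>2 / 2)"
proof -
  let ?P = "pair_pmf (pmf_of_set (boolean_cube d)) (bernoulli_pmf p)"
  let ?f = "gradient_sample g d a b j"
  have "2 * exp (- real n * \<tau>\<^sup>2 / 2) \<ge> measure_pmf.prob (Pi_pmf {..<n} (0\<^sub>v d, False) (\<lambda>_. ?P))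
      {h. \<bar>(\<Sum>l<n. ?f (h l)) / real n - measure_pmf.expectation ?P ?f\<bar> \<ge> \<tau>}"
    using assms by (intro Pi_pmf_Hoeffding) (auto intro: abs_gradient_sample_le_1)
  thus ?thesis
    unfolding expectation_gradient_sample[OF assms(3-7)]
    by (simp add: noisy_data_column[OF assms(2), symmetric] vimage_def flip: column_data_def)
qed

section \<open>Thresholding and recovery of the target subset\<close>

text \<open>The pairs \<open>{2 * m, 2 * m + 1}\<close> partition the indices: index
  \<open>i\<close> lies in pair \<open>i div 2\<close> and in no other, and \<open>e\<close> is
  injective.\<close>

lemma sum_pair_indicator:
  fixes e :: "nat \<Rightarrow> 'a"
  assumes "bij_betw e {..<2 * t} b"
  shows "(\<Sum>m<t. if j \<in> {e (2 * m), e (2 * m + 1)} then 1 else 0) = (indicator b j :: real)"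
proof (cases "j \<in> b")
  case True
  then obtain i where i: "i < 2 * t" "e i = j"
    using assms by (auto simp: bij_betw_def)
  have inj: "inj_on e {..<2 * t}" using assms by (simp add: bij_betw_def)
  have "j \<in> {e (2 * m), e (2 * m + 1)} \<longleftrightarrow> m = i div 2" if "m < t" for m
  proof -
    have "e i = e (2 * m) \<longleftrightarrow> i = 2 * m" "e i = e (2 * m + 1) \<longleftrightarrow> i = 2 * m + 1"
      using i(1) that by (auto intro!: inj_on_eq_iff[OF inj])
    hence "j \<in> {e (2 * m), e (2 * m + 1)} \<longleftrightarrow> i = 2 * m \<or> i = 2 * m + 1"
      unfolding i(2) by blast
    also have "\<dots> \<longleftrightarrow> m = i div 2" by presburger
    finally show ?thesis .
  qed
  hence "(\<Sum>m<t. if j \<in> {e (2 * m), e (2 * m + 1)} then 1 else 0) =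
      (\<Sum>m<t. if m = i div 2 then 1 else (0 :: real))"
    by (intro sum.cong) auto
  also have "\<dots> = 1" using i by simp
  finally show ?thesis using True by simp
next
  case False
  have "e i \<in> b" if "i < 2 * t" for i
    using assms that by (auto simp: bij_betw_def)
  hence "j \<notin> {e (2 * m), e (2 * m + 1)}" if "m < t" for m
    using False that by auto
  thus ?thesis using False by simp
qed

text \<open>Here \<open>P\<close> stands for \<open>d powr (\<epsilon> / 8)\<close>,
  \<open>M\<close> for the empirical mean, \<open>G\<close> for the oracle entry and
  \<open>C\<close> for incidence. After division by \<open>P\<close> the weight exceeds
  \<open>24 / 40 = 0.6\<close> if \<open>C\<close> holds and is below
  \<open>24 * 3 / 200 = 0.36\<close> otherwise; the factor 24 places the threshold 0.5 in
  between.\<close>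

lemma threshold_gradient_entry:
  fixes M P G \<delta> :: real
  assumes "P > 0" "d \<ge> 1000" "p \<in> {0..1/3}" "s = 1 \<or> s = - 1"
    and dev: "\<bar>M + s * (1 - 2 * p) * ((if C then 1 / 8 else 0) - 1 / (4 * real d))\<bar> < 1 / 100"
    and G: "\<bar>G - M / real d\<bar> \<le> \<delta>" and \<delta>: "real d * \<delta> \<le> 1 / 200"
  shows "- (s * 24 * (real d * P) * G) \<le> 0.5 * P \<longleftrightarrow> \<not> C"
proof -
  \<comment> \<open>The oracle error on the scale of \<open>M\<close>.\<close>
  define r where "r = real d * G - M"
  have "r = real d * (G - M / real d)"
    using assms(2) by (simp add: r_def right_diff_distrib)
  hence "\<bar>r\<bar> = real d * \<bar>G - M / real d\<bar>" by (simp add: abs_mult)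
  also have "\<dots> \<le> real d * \<delta>" using G by (intro mult_left_mono) auto
  finally have r: "\<bar>r\<bar> \<le> 1 / 200" using \<delta> by linarith
  define q where "q = (1 - 2 * p) * ((if C then 1 / 8 else 0) - 1 / (4 * real d))"
  \<comment> \<open>Multiplying by \<open>s\<close>, whose square is 1, reduces both gates to one
    case.\<close>
  have dev: "\<bar>s * M + q\<bar> < 1 / 100"
  proof -
    have "\<bar>M + s * q\<bar> < 1 / 100" using dev by (simp add: q_def mult.assoc)
    thus ?thesis using assms(4) by (elim disjE) (simp_all add: abs_minus_commute)
  qed
  have sr: "\<bar>s * r\<bar> \<le> 1 / 200"
    using r assms(4) by auto
  have bnds: "s * M + q < 1 / 100" "- (1 / 100) < s * M + q" "s * r \<le> 1 / 200" "- (1 / 200) \<le> s * r"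
    using dev sr by linarith+
  have inv: "0 \<le> 1 / (4 * real d)" "1 / (4 * real d) \<le> 1 / 4000"
    using assms(2) by (auto simp: field_simps)
  have "- (s * 24 * (real d * P) * G) = 24 * (- (s * M) - s * r) * P"
    by (simp add: r_def algebra_simps)
  hence "- (s * 24 * (real d * P) * G) \<le> 0.5 * P \<longleftrightarrow> 24 * (- (s * M) - s * r) \<le> 0.5"
    using \<open>P > 0\<close> by (simp only: mult_le_cancel_right_pos)
  also have "\<dots> \<longleftrightarrow> \<not> C"
  proof (cases C)
    case True
    \<comment> \<open>The first factor bounds \<open>1 - 2 * p\<close> from below, as
      \<open>p\<close> is at most 1/3.\<close>
    have "(1 / 3) * (1 / 8 - 1 / 4000) \<le> q"
      unfolding q_def using True inv assms(3) by (intro mult_mono) auto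
    hence "1 / 25 \<le> q" by simp
    hence "- (s * M) > 3 / 100" using bnds by linarith
    hence "- (s * M) - s * r > 1 / 48" using bnds by linarith
    thus ?thesis using True by simp
  next
    case False
    have "q \<le> 0" using False inv assms(3) by (auto simp: q_def mult_le_0_iff)
    hence "- (s * M) - s * r \<le> 1 / 48" using bnds by linarith
    thus ?thesis using False by simp
  qed
  finally show ?thesis .
qed

text \<open>The non-asymptotic form of the result. Outside the bad events the thresholded weights
  are exactly the incidence matrix \<open>C\<close>, whose row sums form the indicator of
  \<open>b\<close>.\<close>

lemma one_step_recovery:
  fixes \<epsilon> p :: real
  assumes d: "d \<ge> 1000" and n: "n > 0" and t: "2 * t \<le> d" and p: "p \<in> {0..1/3}"
    and b: "b \<subseteq> {..<d}" and e: "bij_betw e {..<2 * t} b" and \<delta>: "real d * \<delta> \<le> 1 / 200"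
    and orc: "\<forall>\<omega>\<in>set_pmf (noisy_data n d t p).
               approx_gradient_oracle d t \<delta> (data_loss g n d t e \<omega>) (oracle \<omega>)"
  shows "measure_pmf.prob (noisy_data n d t p)
      {\<omega>. map_mat (\<phi> \<epsilon> d) (gradient_step (gate_sign g * 24 * real d powr (1 + \<epsilon> / 8)) (oracle \<omega>) (0\<^sub>m d t))
             *\<^sub>v ones_vec t = indicator_vec d b}
      \<ge> 1 - 2 * (real d)\<^sup>2 * exp (- real n / 20000)"
    (is "measure_pmf.prob ?D ?Good \<ge> _")
proof -
  define C where "C = (\<lambda>j m. j \<in> {e (2 * m), e (2 * m + 1)})"
  define S where "S = (\<lambda>j m \<omega>. (\<Sum>l<n. gradient_sample g d (e (2 * m)) (e (2 * m + 1)) j (column_data m \<omega> l)) / real n)"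
  \<comment> \<open>The deviation 1/100 is the one allowed in
    \<open>threshold_gradient_entry\<close>; it gives \<open>20000 = 2 * 100 ^ 2\<close> in the
    exponent.\<close>
  define Bad where "Bad = (\<lambda>(j, m). {\<omega>. \<bar>S j m \<omega> +
        gate_sign g * (1 - 2 * p) * ((if C j m then 1 / 8 else 0) - 1 / (4 * real d))\<bar> \<ge> 1 / 100})"
  let ?I = "{..<d} \<times> {..<t}"
  have e_less: "e i < d" if "i < 2 * t" for i
    using e b that by (auto simp: bij_betw_def)
  have e_neq: "e (2 * m) \<noteq> e (2 * m + 1)" if "m < t" for m
    using inj_on_eq_iff[of e "{..<2 * t}" "2 * m" "2 * m + 1"] e that by (auto simp: bij_betw_def)
  have bad: "measure_pmf.prob ?D (Bad i) \<le> 2 * exp (- real n / 20000)" if "i \<in> ?I" for i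
  proof -
    obtain j m where i: "i = (j, m)" "j < d" "m < t" using \<open>i \<in> ?I\<close> by auto
    have "measure_pmf.prob ?D (Bad i) \<le> 2 * exp (- real n * (1 / 100)\<^sup>2 / 2)"
      unfolding Bad_def i prod.case S_def C_def
      by (intro gradient_concentration) (use n i e_less e_neq p in auto)
    thus ?thesis by (simp add: power2_eq_square)
  qed
  have "measure_pmf.prob ?D (\<Union>i\<in>?I. Bad i) \<le> (\<Sum>i\<in>?I. measure_pmf.prob ?D (Bad i))"
    by (intro measure_pmf.finite_measure_subadditive_finite) auto
  also have "\<dots> \<le> (\<Sum>i\<in>?I. 2 * exp (- real n / 20000))"
    by (intro sum_mono bad)
  also have "\<dots> = 2 * (real d * real t) * exp (- real n / 20000)" by simp
  also have "\<dots> \<le> 2 * (real d)\<^sup>2 * exp (- real n / 20000)"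
    using t by (intro mult_right_mono mult_left_mono) (auto simp: power2_eq_square intro!: mult_left_mono)
  finally have "measure_pmf.prob ?D (\<Union>i\<in>?I. Bad i) \<le> 2 * (real d)\<^sup>2 * exp (- real n / 20000)" .
  hence "1 - 2 * (real d)\<^sup>2 * exp (- real n / 20000) \<le> measure_pmf.prob ?D (- (\<Union>i\<in>?I. Bad i))"
    using measure_pmf.prob_compl[of "\<Union>i\<in>?I. Bad i" ?D] by (simp add: Compl_eq_Diff_UNIV)
  also have "\<dots> \<le> measure_pmf.prob ?D ?Good"
  \<comment> \<open>The oracle is controlled only on the support of the data, so the inclusion of
    events is shown almost everywhere.\<close>
  proof (intro measure_pmf.finite_measure_mono_AE)
    show "AE \<omega> in measure_pmf ?D. \<omega> \<in> - (\<Union>i\<in>?I. Bad i) \<longrightarrow> \<omega> \<in> ?Good"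
    proof (unfold AE_measure_pmf_iff, intro ballI impI CollectI)
      fix \<omega> assume "\<omega> \<in> set_pmf ?D" and good: "\<omega> \<in> - (\<Union>i\<in>?I. Bad i)"
      hence or: "approx_gradient_oracle d t \<delta> (data_loss g n d t e \<omega>) (oracle \<omega>)"
        using orc by blast
      define G where "G = oracle \<omega> (0\<^sub>m d t)"
      have Gd: "\<bar>G $$ (j, m) - S j m \<omega> / real d\<bar> \<le> \<delta>"
        if "j < d" "m < t" for j m
      proof -
        have "\<bar>G $$ (j, m) - gradient (data_loss g n d t e \<omega>) (0\<^sub>m d t) $$ (j, m)\<bar> \<le> \<delta>"
          using or that unfolding approx_gradient_oracle_def G_def by auto
        thus ?thesis by (simp only: gradient_data_loss_zero[OF that] S_def)
      qed
      have G: "G \<in> carrier_mat d t"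
        using or by (auto simp: approx_gradient_oracle_def G_def)
      let ?W = "gradient_step (gate_sign g * 24 * real d powr (1 + \<epsilon> / 8)) (oracle \<omega>) (0\<^sub>m d t)"
      have entry: "\<phi> \<epsilon> d (?W $$ (j, m)) = (if C j m then 1 else 0)" if "j < d" "m < t" for j m
      proof -
        have W: "?W $$ (j, m) = - (gate_sign g * 24 * (real d * real d powr (\<epsilon> / 8)) * G $$ (j, m))"
          using G d that by (simp add: gradient_step_def G_def powr_add)
        have "?W $$ (j, m) \<le> 0.5 * real d powr (\<epsilon> / 8) \<longleftrightarrow> \<not> C j m"
          unfolding W
        proof (rule threshold_gradient_entry[OF _ d p _ _ Gd \<delta>])
          have "\<omega> \<notin> Bad (j, m)" using good that by blast
          thus "\<bar>S j m \<omega> + gate_sign g * (1 - 2 * p) * ((if C j m then 1 / 8 else 0) - 1 / (4 * real d))\<bar> < 1 / 100"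
            by (simp add: Bad_def not_le)
        qed (use that d in \<open>auto simp: gate_sign_def split: gate.split\<close>)
        thus ?thesis by (simp add: \<phi>_def)
      qed
      have W: "?W \<in> carrier_mat d t" using G by (auto simp: gradient_step_def G_def)
      show "map_mat (\<phi> \<epsilon> d) ?W *\<^sub>v ones_vec t = indicator_vec d b"
      proof (intro eq_vecI)
        fix j assume "j < dim_vec (indicator_vec d b)"
        hence j: "j < d" by (simp add: indicator_vec_def)
        have "vec_index (map_mat (\<phi> \<epsilon> d) ?W *\<^sub>v ones_vec t) j = (\<Sum>m<t. \<phi> \<epsilon> d (?W $$ (j, m)))"
          using W j by (simp add: ones_vec_def scalar_prod_def lessThan_atLeast0)
        also have "\<dots> = (\<Sum>m<t. if C j m then 1 else 0)"
          using j by (intro sum.cong) (auto simp: entry)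
        also have "\<dots> = indicator b j" unfolding C_def by (rule sum_pair_indicator[OF e])
        finally show "vec_index (map_mat (\<phi> \<epsilon> d) ?W *\<^sub>v ones_vec t) j = vec_index (indicator_vec d b) j"
          using j by (simp add: indicator_vec_def)
      qed (use W in \<open>auto simp: indicator_vec_def\<close>)
    qed
  qed auto
  finally show ?thesis .
qed

section \<open>Choice of the step size and asymptotics in the dimension\<close>

theorem theoremG2:
  fixes \<epsilon> :: real and g :: gate
  assumes "\<epsilon> > 0"
  shows "\<exists>\<eta> :: nat \<Rightarrow> real.
    \<eta> \<in> \<Theta>(\<lambda>d. real d powr (1 + \<epsilon> / 8)) \<and>
    (g = Noisy_AND \<longrightarrow> (\<forall>\<^sub>F d in sequentially. \<eta> d > 0)) \<and>
    (\<forall>(k :: nat \<Rightarrow> nat) (n :: nat \<Rightarrow> nat) (\<delta> :: nat \<Rightarrow> real).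
       (\<lambda>d. real (k d)) \<in> \<Theta>(\<lambda>d. real d) \<longrightarrow>
       (\<forall>\<^sub>F d in sequentially. even (k d) \<and> 2 \<le> k d \<and> k d \<le> d) \<longrightarrow>
       (\<lambda>d. real (n d)) \<in> \<Omega>(\<lambda>d. real d powr \<epsilon>) \<longrightarrow>
       \<delta> \<in> O(\<lambda>d. real d powr (- 1 - \<epsilon> / 4)) \<longrightarrow>
       (\<exists>c>0. \<forall>\<^sub>F d in sequentially.
          \<forall>p\<in>{0..1/3}. \<forall>b e. \<forall>oracle :: sample_data \<Rightarrow> real mat \<Rightarrow> real mat.
            b \<subseteq> {..<d} \<longrightarrow> card b = k d \<longrightarrow> bij_betw e {..<k d} b \<longrightarrow>
            (\<forall>\<omega>\<in>set_pmf (noisy_data (n d) d (k d div 2) p).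
               approx_gradient_oracle d (k d div 2) (\<delta> d)
                 (data_loss g (n d) d (k d div 2) e \<omega>) (oracle \<omega>)) \<longrightarrow>
            measure_pmf.prob (noisy_data (n d) d (k d div 2) p)
              {\<omega>. map_mat (\<phi> \<epsilon> d) (gradient_step (\<eta> d) (oracle \<omega>) (0\<^sub>m d (k d div 2)))
                     *\<^sub>v ones_vec (k d div 2) = indicator_vec d b}
            \<ge> 1 - exp (- c * real d powr (\<epsilon> / 2))))"
\<comment> \<open>For \<open>Noisy_OR\<close> the expected gradient entries at incident pairs are
  positive, so the step has to go uphill; \<open>gate_sign g\<close> makes it do so.\<close>
proof (intro exI[of _ "\<lambda>d. gate_sign g * 24 * real d powr (1 + \<epsilon> / 8)"] conjI impI allI)
  show "(\<lambda>d. gate_sign g * 24 * real d powr (1 + \<epsilon> / 8)) \<in> \<Theta>(\<lambda>d. real d powr (1 + \<epsilon> / 8))"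
    by (cases g) (simp_all add: gate_sign_def)
next
  assume "g = Noisy_AND"
  thus "\<forall>\<^sub>F d in sequentially. 0 < gate_sign g * 24 * real d powr (1 + \<epsilon> / 8)"
    using eventually_gt_at_top[of 0] by (auto elim!: eventually_mono simp: gate_sign_def)
next
  fix k n :: "nat \<Rightarrow> nat" and \<delta> :: "nat \<Rightarrow> real"
  assume k: "\<forall>\<^sub>F d in sequentially. even (k d) \<and> 2 \<le> k d \<and> k d \<le> d"
    and n: "(\<lambda>d. real (n d)) \<in> \<Omega>(\<lambda>d. real d powr \<epsilon>)"
    and \<delta>: "\<delta> \<in> O(\<lambda>d. real d powr (- 1 - \<epsilon> / 4))"
  from n obtain c where c: "c > 0" "\<forall>\<^sub>F d in sequentially. c * real d powr \<epsilon> \<le> real (n d)"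
    by (auto elim!: landau_omega.bigE)
  from \<delta> obtain C where C: "C > 0" "\<forall>\<^sub>F d in sequentially. \<bar>\<delta> d\<bar> \<le> C * real d powr (- 1 - \<epsilon> / 4)"
    by (auto elim!: landau_o.bigE)
  \<comment> \<open>The product is \<open>C * d powr (- \<epsilon> / 4)\<close>, which tends to
    0.\<close>
  have small: "\<forall>\<^sub>F d in sequentially. real d * (C * real d powr (- 1 - \<epsilon> / 4)) \<le> 1 / 200"
    using assms C(1) by real_asymp
  \<comment> \<open>The logarithm of the failure bound: \<open>d powr \<epsilon>\<close> outgrows
    both \<open>d powr (\<epsilon> / 2)\<close> and the logarithmic cost of the union bound,
    whatever the constant \<open>c\<close>. This is why 1 can serve as the constant in the final
    exponent.\<close>
  have "LIM (d :: nat) sequentially.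
      c / 20000 * real d powr \<epsilon> - real d powr (\<epsilon> / 2) - ln (2 * (real d)\<^sup>2) :> at_top"
    using assms c(1) by real_asymp
  hence "\<forall>\<^sub>F d in sequentially.
      0 \<le> c / 20000 * real d powr \<epsilon> - real d powr (\<epsilon> / 2) - ln (2 * (real d)\<^sup>2)"
    unfolding filterlim_at_top by blast
  hence tail: "\<forall>\<^sub>F d in sequentially.
      2 * (real d)\<^sup>2 * exp (- (c * real d powr \<epsilon>) / 20000) \<le> exp (- 1 * real d powr (\<epsilon> / 2))"
    using eventually_gt_at_top[of 0]
  proof eventually_elim
    case (elim d)
    have "2 * (real d)\<^sup>2 * exp (- (c * real d powr \<epsilon>) / 20000) =
        exp (ln (2 * (real d)\<^sup>2) + - (c * real d powr \<epsilon>) / 20000)"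
      using elim(2) by (simp only: exp_add) simp
    also have "\<dots> \<le> exp (- 1 * real d powr (\<epsilon> / 2))"
      using elim(1) by simp
    finally show ?case .
  qed
  show "\<exists>c>0. \<forall>\<^sub>F d in sequentially.
          \<forall>p\<in>{0..1/3}. \<forall>b e. \<forall>oracle :: sample_data \<Rightarrow> real mat \<Rightarrow> real mat.
            b \<subseteq> {..<d} \<longrightarrow> card b = k d \<longrightarrow> bij_betw e {..<k d} b \<longrightarrow>
            (\<forall>\<omega>\<in>set_pmf (noisy_data (n d) d (k d div 2) p).
               approx_gradient_oracle d (k d div 2) (\<delta> d)
                 (data_loss g (n d) d (k d div 2) e \<omega>) (oracle \<omega>)) \<longrightarrow>
            measure_pmf.prob (noisy_data (n d) d (k d div 2) p)
              {\<omega>. map_mat (\<phi> \<epsilon> d) (gradient_step (gate_sign g * 24 * real d powr (1 + \<epsilon> / 8)) (oracle \<omega>) (0\<^sub>m d (k d div 2)))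
                     *\<^sub>v ones_vec (k d div 2) = indicator_vec d b}
            \<ge> 1 - exp (- c * real d powr (\<epsilon> / 2))"
    (is "\<exists>c>0. ?P c")
  proof (intro exI[of _ 1] conjI)
    show "?P 1"
      using k c(2) C(2) small tail eventually_ge_at_top[of 1000]
    proof eventually_elim
      case (elim d)
      have "real d powr \<epsilon> > 0" using elim by simp
      hence "0 < real (n d)"
        using elim(2) c(1) by (meson less_le_trans mult_pos_pos)
      hence "n d > 0" by simp
      have "real d * \<delta> d \<le> real d * (C * real d powr (- 1 - \<epsilon> / 4))"
        using elim(3) by (intro mult_left_mono) auto
      also have "\<dots> \<le> 1 / 200" by (fact elim(4))
      finally have \<delta>d: "real d * \<delta> d \<le> 1 / 200" .
      have "1 - exp (- 1 * real d powr (\<epsilon> / 2)) \<le> 1 - 2 * (real d)\<^sup>2 * exp (- (c * real d powr \<epsilon>) / 20000)"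
        using elim(5) by linarith
      also have "\<dots> \<le> 1 - 2 * (real d)\<^sup>2 * exp (- real (n d) / 20000)"
        using elim(2) by (intro diff_left_mono mult_left_mono) auto
      finally have bound: "1 - exp (- 1 * real d powr (\<epsilon> / 2)) \<le>
        1 - 2 * (real d)\<^sup>2 * exp (- real (n d) / 20000)" .
      have k2: "2 * (k d div 2) = k d" using elim(1) by simp
      show ?case
      proof (intro ballI allI impI)
        fix p b e and G :: "sample_data \<Rightarrow> real mat \<Rightarrow> real mat"
        assume p: "p \<in> {0..1/3}" and b: "b \<subseteq> {..<d}" and e: "bij_betw e {..<k d} b"
          and G: "\<forall>\<omega>\<in>set_pmf (noisy_data (n d) d (k d div 2) p).
               approx_gradient_oracle d (k d div 2) (\<delta> d) (data_loss g (n d) d (k d div 2) e \<omega>) (G \<omega>)"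
        have e': "bij_betw e {..<2 * (k d div 2)} b" and t: "2 * (k d div 2) \<le> d"
          using e k2 elim(1) by simp_all
        note bound
        also note one_step_recovery[OF elim(6) \<open>n d > 0\<close> t p b e' \<delta>d G]
        finally show "1 - exp (- 1 * real d powr (\<epsilon> / 2)) \<le> measure_pmf.prob (noisy_data (n d) d (k d div 2) p)
              {\<omega>. map_mat (\<phi> \<epsilon> d) (gradient_step (gate_sign g * 24 * real d powr (1 + \<epsilon> / 8)) (G \<omega>) (0\<^sub>m d (k d div 2)))
                     *\<^sub>v ones_vec (k d div 2) = indicator_vec d b}" .
      qed
    qed
  qed auto
qed

end
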